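(* Fix $t>0$ and basis functions $\psi_1,\dots,\psi_N$. Let the data $x_1,\dots,x_T$, $y_1,\dots,y_T$ be generated from the SDE in one of the following two ways, and suppose that there is a constant $\tilde\gamma>0$, not depending on $T$, such that for all $f,g\in\{\psi_1,\dots,\psi_N\}$ the corresponding bound holds: (i) (independent sampling) the $x_k$ are i.i.d. with law $\mu$, each $y_k$ is a realisation of $X_t^{x_k}$, with the pairs $(x_k,y_k)$ independent, and $\mathbb{E}_{x\sim\mu}\bigl[g(x)^2\,\mathrm{Var}_W[f(X_t^{x})]\bigr]\le\tilde\gamma$; (ii) (Markov chain sampling) $x_1\in\mathcal{M}$ is a known point, $x_{k+1}=X_t^{x_k}$ and $y_k=x_{k+1}$, and for every $k\ge1$, $\mathbb{E}\bigl[g(x_k)^2\,v_f(x_k)\bigr]\le\tilde\gamma$, where $v_f(x):=\mathrm{Var}_W[f(X_t^{x})]$. Let $\gamma>0$ be a constant independent of $T$ such that $\mathbb{E}_{\mathbf{X},\mathbf{Y}}\|K_{\mu_T}-\hat K_T\|_F^2\le\gamma T^{-1}$, where $K_{\mu_T}=\frac1T(\mathcal{K}^t\psi(\mathbf{X}))\psi(\mathbf{X})^{\intercal}$ and $\hat K_T=\frac1T\psi(\mathbf{Y})\psi(\mathbf{X})^{\intercal}$ (such a $\gamma$ exists, for instance $\gamma=N^2\tilde\gamma$, when the data are generated by independent sampling with $\mathbb{E}_{x\sim\mu}\bigl[g(x)^2\,\mathrm{Var}_W[f(X_t^{x})]\bigr]\le\tilde\gamma$ for all $f,g\in\{\psi_1,\dots,\psi_N\}$,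 or by Markov chain sampling with $\mathbb{E}\bigl[g(x_k)^2\,v_f(x_k)\bigr]\le\tilde\gamma$ for all $k\ge1$ and all $f,g\in\{\psi_1,\dots,\psi_N\}$). Let $M_{\mu_T}=\frac1T\psi(\mathbf{X})\psi(\mathbf{X})^{\intercal}$, and assume further that, for all sample sizes $T$ under consideration, $M_{\mu_T}$ is almost surely invertible and $$\mathbb{E}_{\mathbf{X}}\bigl\|M_{\mu_T}^{-1}\bigr\|_F^2\le\tilde M$$ for some $\tilde M>0$ independent of $T$. Then, for all such $T$, the matrix representations $A_{\mu_T}=K_{\mu_T}M_{\mu_T}^{-1}$ of the projected Koopman operator and $\hat A_T=\hat K_TM_{\mu_T}^{-1}$ of the EDMD operator satisfy $$\mathbb{E}_{\mathbf{X},\mathbf{Y}}\bigl\|A_{\mu_T}-\hat A_T\bigr\|_F\le\sqrt{\frac{\gamma\tilde M}{T}}.$$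
   Context: Setting: $\mathcal{M}\subset\mathbb{R}$ is the state space of the one-dimensional autonomous SDE $\mathrm{d}X_t = a(X_t;\theta)\,\mathrm{d}t + b(X_t;\theta)\,\mathrm{d}W_t$ with a fixed parameter $\theta$, where $W$ is a standard Brownian motion and $a,b$ are such that a strong solution exists for all relevant initial conditions. $X_t^x$ denotes the solution at time $t$ started at $X_0=x$. The notation $x_{k+1}=X_t^{x_k}$ means that, conditionally on the past $x_1,\dots,x_k$, the point $x_{k+1}$ has the law of $X_t^{x}$ with $x=x_k$ (driven by fresh Brownian increments). $\mathbb{E}_W$ and $\mathrm{Var}_W$ denote expectation and variance over the Brownian motion. The time-$t$ Koopman operator acts on measurable functions $g:\mathcal{M}\to\mathbb{R}$ with $g(X_t^x)$ integrable by $\mathcal{K}^tg(x)=\mathbb{E}_W[g(X_t^x)]$. The measure $\mu$ is a probability measure on $\mathcal{M}$. The basis functions $\psi_1,\dots,\psi_N:\mathcal{M}\to\mathbb{R}$ are linearly independent and belong to a subspace of $L^2(\mathcal{M},\mu)$ that is invariant under all $\mathcal{K}^t$, $t\ge0$. Notation: $\psi(x)=[\psi_1(x),\dots,\psi_N(x)]^{\intercal}$; $\mathbf{X}=[x_1,\dots,x_T]$, $\mathbf{Y}=[y_1,\dots,y_T]$; $\psi(\mathbf{X})=[\psi(x_1),\dots,\psi(x_T)]$, $\psi(\mathbf{Y})=[\psi(y_1),\dots,\psi(y_T)]$, and $\mathcal{K}^t\psi(\mathbf{X})=[\mathcal{K}^t\psi(x_1),\dots,\mathcal{K}^t\psi(x_T)]$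 (with $\mathcal{K}^t$ applied componentwise) are $N\times T$ matrices. $\mu_T=\frac1T\sum_{j=1}^T\delta_{x_j}$ is the empirical measure. $\|A\|_F^2=\sum_{i,j}|A_{i,j}|^2$ is the squared Frobenius norm. *)

theory Defs
  imports "HOL-Probability.Probability"
begin

section \<open>Brownian motion, Ito integrals and strong solutions\<close>

definition generated_sigma :: "'w measure \<Rightarrow> 'a measure \<Rightarrow> ('i \<Rightarrow> 'w \<Rightarrow> 'a) \<Rightarrow> 'i set \<Rightarrow> 'w measure" where
  "generated_sigma P N Z J = sigma (space P) (\<Union>j\<in>J. {Z j -` A \<inter> space P |A. A \<in> sets N})"

definition brownian_motion :: "'w measure \<Rightarrow> (real \<Rightarrow> 'w \<Rightarrow> real) \<Rightarrow> bool" where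
  "brownian_motion P W \<longleftrightarrow>
     prob_space P \<and>
     (\<forall>t\<ge>0. W t \<in> borel_measurable P) \<and>
     (AE \<omega> in P. W 0 \<omega> = 0) \<and>
     (\<forall>\<omega>\<in>space P. continuous_on {0..} (\<lambda>t. W t \<omega>)) \<and>
     (\<forall>s t. 0 \<le> s \<and> s < t \<longrightarrow>
        distributed P lborel (\<lambda>\<omega>. W t \<omega> - W s \<omega>) (\<lambda>z. ennreal (normal_density 0 (sqrt (t - s)) z)) \<and>
        prob_space.indep_set P
          (sets (generated_sigma P borel W {0..s}))
          (sets (vimage_algebra (space P) (\<lambda>\<omega>. W t \<omega> - W s \<omega>) borel)))"

text \<open>The null sets are included so that solutions, which are determined only almost surely,
  may be adapted to the filtration of the Brownian motion.\<close>

definition brownian_filtration :: "'w measure \<Rightarrow> (real \<Rightarrow> 'w \<Rightarrow> real) \<Rightarrow> real \<Rightarrow> 'w measure" where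
  "brownian_filtration P W s =
     sigma (space P) (sets (generated_sigma P borel W {0..s}) \<union> null_sets P)"

definition null_in_probability :: "'w measure \<Rightarrow> (nat \<Rightarrow> 'w \<Rightarrow> ennreal) \<Rightarrow> bool" where
  "null_in_probability P Z \<longleftrightarrow>
     (\<forall>m. Z m \<in> borel_measurable P) \<and>
     (\<forall>\<epsilon>>0. (\<lambda>m. measure P {\<omega> \<in> space P. ennreal \<epsilon> < Z m \<omega>}) \<longlonglongrightarrow> 0)"

text \<open>A triple \<open>n, \<tau>, \<xi>\<close> encodes the elementary integrand equal to \<open>\<xi> i\<close> on
  \<open>(\<tau> i, \<tau> (i + 1)]\<close> for \<open>i < n\<close>, and zero elsewhere.\<close>

definition elementary_process ::
  "'w measure \<Rightarrow> (real \<Rightarrow> 'w \<Rightarrow> real) \<Rightarrow> nat \<Rightarrow> (nat \<Rightarrow> real) \<Rightarrow> (nat \<Rightarrow> 'w \<Rightarrow> real) \<Rightarrow> bool" where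
  "elementary_process P W n \<tau> \<xi> \<longleftrightarrow>
     (\<forall>i<n. 0 \<le> \<tau> i \<and> \<tau> i \<le> \<tau> (Suc i) \<and>
        \<xi> i \<in> borel_measurable (brownian_filtration P W (\<tau> i)) \<and>
        (\<exists>C. \<forall>\<omega>\<in>space P. \<bar>\<xi> i \<omega>\<bar> \<le> C))"

definition elementary_value :: "nat \<Rightarrow> (nat \<Rightarrow> real) \<Rightarrow> (nat \<Rightarrow> 'w \<Rightarrow> real) \<Rightarrow> real \<Rightarrow> 'w \<Rightarrow> real" where
  "elementary_value n \<tau> \<xi> s \<omega> = (\<Sum>i<n. \<xi> i \<omega> * indicator {\<tau> i<..\<tau> (Suc i)} s)"

definition elementary_integral ::
  "(real \<Rightarrow> 'w \<Rightarrow> real) \<Rightarrow> nat \<Rightarrow> (nat \<Rightarrow> real) \<Rightarrow> (nat \<Rightarrow> 'w \<Rightarrow> real) \<Rightarrow> real \<Rightarrow> 'w \<Rightarrow> real" where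
  "elementary_integral W n \<tau> \<xi> t \<omega> =
     (\<Sum>i<n. \<xi> i \<omega> * (W (min (\<tau> (Suc i)) t) \<omega> - W (min (\<tau> i) t) \<omega>))"

text \<open>\<open>ito_integral P W H I\<close> says that \<open>I t\<close> is a version of the Ito integral of \<open>H\<close> over \<open>[0, t]\<close>,
  for every \<open>t \<ge> 0\<close>: the limit in probability of the integrals of elementary processes \<open>H\<^sub>m\<close> with
  \<open>\<integral>\<^sub>0\<^sup>t (H\<^sub>m - H)\<^sup>2 ds \<longlonglongrightarrow> 0\<close> in probability.\<close>

definition ito_integral ::
  "'w measure \<Rightarrow> (real \<Rightarrow> 'w \<Rightarrow> real) \<Rightarrow> (real \<Rightarrow> 'w \<Rightarrow> real) \<Rightarrow> (real \<Rightarrow> 'w \<Rightarrow> real) \<Rightarrow> bool" where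
  "ito_integral P W H I \<longleftrightarrow>
     (\<lambda>(s, \<omega>). H s \<omega>) \<in> borel_measurable (restrict_space borel {0..} \<Otimes>\<^sub>M P) \<and>
     (\<forall>s\<ge>0. H s \<in> borel_measurable (brownian_filtration P W s)) \<and>
     (\<forall>t\<ge>0. I t \<in> borel_measurable P) \<and>
     (\<exists>n \<tau> \<xi>.
        (\<forall>m. elementary_process P W (n m) (\<tau> m) (\<xi> m)) \<and>
        (\<forall>t\<ge>0.
           null_in_probability P (\<lambda>m \<omega>. \<integral>\<^sup>+s\<in>{0..t}.
             ennreal ((elementary_value (n m) (\<tau> m) (\<xi> m) s \<omega> - H s \<omega>)\<^sup>2) \<partial>lborel) \<and>
           null_in_probability P (\<lambda>m \<omega>.
             ennreal \<bar>elementary_integral W (n m) (\<tau> m) (\<xi> m) t \<omega> - I t \<omega>\<bar>)))"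

definition strong_solution ::
  "'w measure \<Rightarrow> (real \<Rightarrow> 'w \<Rightarrow> real) \<Rightarrow> (real \<Rightarrow> 'p \<Rightarrow> real) \<Rightarrow> (real \<Rightarrow> 'p \<Rightarrow> real) \<Rightarrow> 'p \<Rightarrow>
   real set \<Rightarrow> real \<Rightarrow> (real \<Rightarrow> 'w \<Rightarrow> real) \<Rightarrow> bool" where
  "strong_solution P W a b \<theta> S x Z \<longleftrightarrow>
     (\<forall>t\<ge>0. Z t \<in> borel_measurable (brownian_filtration P W t)) \<and>
     (\<forall>\<omega>\<in>space P. continuous_on {0..} (\<lambda>t. Z t \<omega>) \<and> (\<forall>t\<ge>0. Z t \<omega> \<in> S)) \<and>
     (AE \<omega> in P. \<forall>t\<ge>0. set_integrable lborel {0..t} (\<lambda>s. a (Z s \<omega>) \<theta>)) \<and>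
     (\<exists>I. ito_integral P W (\<lambda>s \<omega>. b (Z s \<omega>) \<theta>) I \<and>
        (\<forall>t\<ge>0. AE \<omega> in P. Z t \<omega> = x + (LINT s:{0..t}|lborel. a (Z s \<omega>) \<theta>) + I t \<omega>))"

section \<open>Transition law, Koopman operator and observables\<close>

text \<open>Below, \<open>S\<close> is the state space and \<open>X t x\<close> is the solution at time \<open>t\<close> started at \<open>x\<close>.
  Functions on \<open>S\<close> are total functions whose values outside \<open>S\<close> are irrelevant.\<close>

abbreviation state_borel :: "real set \<Rightarrow> real measure" where
  "state_borel S \<equiv> restrict_space borel S"

definition transition_law ::
  "'w measure \<Rightarrow> real set \<Rightarrow> (real \<Rightarrow> real \<Rightarrow> 'w \<Rightarrow> real) \<Rightarrow> real \<Rightarrow> real \<Rightarrow> real measure" where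
  "transition_law P S X t x = distr P (state_borel S) (X t x)"

definition koopman_domain ::
  "'w measure \<Rightarrow> real set \<Rightarrow> (real \<Rightarrow> real \<Rightarrow> 'w \<Rightarrow> real) \<Rightarrow> real \<Rightarrow> (real \<Rightarrow> real) set" where
  "koopman_domain P S X t =
     {g \<in> borel_measurable (state_borel S). \<forall>x\<in>S. integrable P (\<lambda>\<omega>. g (X t x \<omega>))}"

definition koopman ::
  "'w measure \<Rightarrow> (real \<Rightarrow> real \<Rightarrow> 'w \<Rightarrow> real) \<Rightarrow> real \<Rightarrow> (real \<Rightarrow> real) \<Rightarrow> real \<Rightarrow> real" where
  "koopman P X t g x = (\<integral>\<omega>. g (X t x \<omega>) \<partial>P)"

text \<open>The variance of \<open>f (X t x)\<close>; it is \<open>ennreal\<close>-valued, so an infinite variance is \<open>\<infinity>\<close>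
  (a Bochner integral would be zero instead).\<close>

definition transition_variance ::
  "'w measure \<Rightarrow> (real \<Rightarrow> real \<Rightarrow> 'w \<Rightarrow> real) \<Rightarrow> real \<Rightarrow> (real \<Rightarrow> real) \<Rightarrow> real \<Rightarrow> ennreal" where
  "transition_variance P X t f x = (\<integral>\<^sup>+\<omega>. ennreal ((f (X t x \<omega>) - koopman P X t f x)\<^sup>2) \<partial>P)"

text \<open>Elements of \<open>V\<close> are representatives of classes in \<open>L\<^sup>2(\<mu>)\<close>; hence invariance is
  membership up to \<open>\<mu>\<close>-null sets.\<close>

definition invariant_L2_subspace ::
  "'w measure \<Rightarrow> real set \<Rightarrow> (real \<Rightarrow> real \<Rightarrow> 'w \<Rightarrow> real) \<Rightarrow> real measure \<Rightarrow> (real \<Rightarrow> real) set \<Rightarrow> bool" where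
  "invariant_L2_subspace P S X \<mu> V \<longleftrightarrow>
     (\<forall>f\<in>V. f \<in> borel_measurable \<mu> \<and> integrable \<mu> (\<lambda>x. (f x)\<^sup>2)) \<and>
     (\<lambda>_. 0) \<in> V \<and>
     (\<forall>f\<in>V. \<forall>g\<in>V. (\<lambda>x. f x + g x) \<in> V) \<and>
     (\<forall>c. \<forall>f\<in>V. (\<lambda>x. c * f x) \<in> V) \<and>
     (\<forall>s\<ge>0. \<forall>f\<in>V. f \<in> koopman_domain P S X s \<and>
        (\<exists>h\<in>V. AE x in \<mu>. koopman P X s f x = h x))"

definition lin_indep_on :: "real set \<Rightarrow> ('n::finite \<Rightarrow> real \<Rightarrow> real) \<Rightarrow> bool" where
  "lin_indep_on S \<psi> \<longleftrightarrow>
     (\<forall>c. (\<forall>x\<in>S. (\<Sum>i\<in>UNIV. c i * \<psi> i x) = 0) \<longrightarrow> (\<forall>i. c i = 0))"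

section \<open>Data\<close>

text \<open>\<open>Q \<omega>\<close> is the conditional law of \<open>Y\<close> given the sub-sigma-algebra \<open>F\<close>.\<close>

definition has_cond_law ::
  "'d measure \<Rightarrow> 'd measure \<Rightarrow> real measure \<Rightarrow> ('d \<Rightarrow> real) \<Rightarrow> ('d \<Rightarrow> real measure) \<Rightarrow> bool" where
  "has_cond_law D F N Y Q \<longleftrightarrow>
     (\<forall>B\<in>sets N. AE \<omega> in D.
        real_cond_exp D F (indicator (Y -` B \<inter> space D)) \<omega> = measure (Q \<omega>) B)"

text \<open>\<open>law x\<close> is the law of the successor of the state \<open>x\<close>. A sample of size \<open>T\<close> is indexed by
  \<open>{1..T}\<close>.\<close>

definition independent_sampling ::
  "'d measure \<Rightarrow> real set \<Rightarrow> real measure \<Rightarrow> (real \<Rightarrow> real measure) \<Rightarrow> nat \<Rightarrow>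
   (nat \<Rightarrow> 'd \<Rightarrow> real) \<Rightarrow> (nat \<Rightarrow> 'd \<Rightarrow> real) \<Rightarrow> bool" where
  "independent_sampling D S \<mu> law T x y \<longleftrightarrow>
     prob_space D \<and>
     (\<forall>k\<in>{1..T}. x k \<in> D \<rightarrow>\<^sub>M state_borel S \<and> y k \<in> D \<rightarrow>\<^sub>M state_borel S) \<and>
     prob_space.indep_vars D (\<lambda>_. state_borel S \<Otimes>\<^sub>M state_borel S) (\<lambda>k \<omega>. (x k \<omega>, y k \<omega>)) {1..T} \<and>
     (\<forall>k\<in>{1..T}. distr D (state_borel S) (x k) = \<mu> \<and>
        has_cond_law D (generated_sigma D (state_borel S) x {k}) (state_borel S) (y k)
          (\<lambda>\<omega>. law (x k \<omega>)))"

definition markov_sampling ::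
  "'d measure \<Rightarrow> real set \<Rightarrow> (real \<Rightarrow> real measure) \<Rightarrow> nat \<Rightarrow>
   (nat \<Rightarrow> 'd \<Rightarrow> real) \<Rightarrow> (nat \<Rightarrow> 'd \<Rightarrow> real) \<Rightarrow> bool" where
  "markov_sampling D S law T x y \<longleftrightarrow>
     prob_space D \<and>
     (\<forall>k\<in>{1..Suc T}. x k \<in> D \<rightarrow>\<^sub>M state_borel S) \<and>
     (\<exists>p\<in>S. \<forall>\<omega>\<in>space D. x 1 \<omega> = p) \<and>
     (\<forall>k\<in>{1..T}. (\<forall>\<omega>\<in>space D. y k \<omega> = x (Suc k) \<omega>) \<and>
        has_cond_law D (generated_sigma D (state_borel S) x {1..k}) (state_borel S) (x (Suc k))
          (\<lambda>\<omega>. law (x k \<omega>)))"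

section \<open>Empirical matrices\<close>

text \<open>An \<open>N \<times> T\<close> matrix is given by its columns \<open>U 1, \<dots>, U T\<close>;
  \<open>mean_outer T U V\<close> is the product \<open>1/T U V\<^sup>T\<close>.\<close>

definition mean_outer :: "nat \<Rightarrow> (nat \<Rightarrow> real^'n) \<Rightarrow> (nat \<Rightarrow> real^'n) \<Rightarrow> real^'n^'n" where
  "mean_outer T U V = (\<chi> i j. (1 / real T) * (\<Sum>k=1..T. U k $ i * V k $ j))"

definition obs_vec :: "('n::finite \<Rightarrow> real \<Rightarrow> real) \<Rightarrow> real \<Rightarrow> real^'n" where
  "obs_vec \<psi> x = (\<chi> i. \<psi> i x)"

definition M_emp :: "('n::finite \<Rightarrow> real \<Rightarrow> real) \<Rightarrow> nat \<Rightarrow> (nat \<Rightarrow> real) \<Rightarrow> real^'n^'n" where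
  "M_emp \<psi> T xs = mean_outer T (\<lambda>k. obs_vec \<psi> (xs k)) (\<lambda>k. obs_vec \<psi> (xs k))"

definition K_emp ::
  "'w measure \<Rightarrow> (real \<Rightarrow> real \<Rightarrow> 'w \<Rightarrow> real) \<Rightarrow> real \<Rightarrow> ('n::finite \<Rightarrow> real \<Rightarrow> real) \<Rightarrow>
   nat \<Rightarrow> (nat \<Rightarrow> real) \<Rightarrow> real^'n^'n" where
  "K_emp P X t \<psi> T xs =
     mean_outer T (\<lambda>k. obs_vec (\<lambda>i. koopman P X t (\<psi> i)) (xs k)) (\<lambda>k. obs_vec \<psi> (xs k))"

definition K_hat ::
  "('n::finite \<Rightarrow> real \<Rightarrow> real) \<Rightarrow> nat \<Rightarrow> (nat \<Rightarrow> real) \<Rightarrow> (nat \<Rightarrow> real) \<Rightarrow> real^'n^'n" where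
  "K_hat \<psi> T xs ys = mean_outer T (\<lambda>k. obs_vec \<psi> (ys k)) (\<lambda>k. obs_vec \<psi> (xs k))"

definition A_emp ::
  "'w measure \<Rightarrow> (real \<Rightarrow> real \<Rightarrow> 'w \<Rightarrow> real) \<Rightarrow> real \<Rightarrow> ('n::finite \<Rightarrow> real \<Rightarrow> real) \<Rightarrow>
   nat \<Rightarrow> (nat \<Rightarrow> real) \<Rightarrow> real^'n^'n" where
  "A_emp P X t \<psi> T xs = K_emp P X t \<psi> T xs ** matrix_inv (M_emp \<psi> T xs)"

definition A_hat ::
  "('n::finite \<Rightarrow> real \<Rightarrow> real) \<Rightarrow> nat \<Rightarrow> (nat \<Rightarrow> real) \<Rightarrow> (nat \<Rightarrow> real) \<Rightarrow> real^'n^'n" where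
  "A_hat \<psi> T xs ys = K_hat \<psi> T xs ys ** matrix_inv (M_emp \<psi> T xs)"

definition frob_norm :: "real^'n^'m \<Rightarrow> real" where
  "frob_norm A = sqrt (\<Sum>i\<in>UNIV. \<Sum>j\<in>UNIV. \<bar>A $ i $ j\<bar>\<^sup>2)"

end

theory Submission
  imports Defs
begin

text \<open>The \<open>(i, j)\<close> entry of \<open>K_emp - K_hat\<close> is the average of the noise terms
  \<open>(K\<^sup>t \<psi>\<^sub>i (x\<^sub>k) - \<psi>\<^sub>i (y\<^sub>k)) \<psi>\<^sub>j (x\<^sub>k)\<close>. Conditioning on the past of \<open>y\<^sub>k\<close> shows that each has second
  moment \<open>E [\<psi>\<^sub>j (x\<^sub>k)\<^sup>2 Var [\<psi>\<^sub>i (X\<^sub>t)]]\<close> and that distinct ones are orthogonal: independent and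
  centred in the first sampling scheme, martingale differences in the second. Hence the variance of
  the average decays like \<open>1 / T\<close>. The bound for the operators then follows from submultiplicativity
  of the Frobenius norm and the Cauchy-Schwarz inequality.\<close>

section \<open>Generated sigma-algebras and measurability of strong solutions\<close>

lemma generated_sigma_subalgebra:
  assumes "\<And>j. j \<in> J \<Longrightarrow> Z j \<in> M \<rightarrow>\<^sub>M N"
  shows "subalgebra M (generated_sigma M N Z J)"
proof -
  have "(\<Union>j\<in>J. {Z j -` A \<inter> space M |A. A \<in> sets N}) \<subseteq> sets M"
    using assms by (auto intro: measurable_sets)
  then show ?thesis
    unfolding subalgebra_def generated_sigma_def
    by (simp add: sets.sigma_sets_subset sets_measure_of_conv space_measure_of_conv)
qed

lemma measurable_generated_sigma:
  assumes "j \<in> J" "Z j \<in> space M \<rightarrow> space N"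
  shows "Z j \<in> generated_sigma M N Z J \<rightarrow>\<^sub>M N"
proof (rule measurableI)
  show "Z j w \<in> space N" if "w \<in> space (generated_sigma M N Z J)" for w
    using that assms by (auto simp: generated_sigma_def space_measure_of_conv)
  show "Z j -` A \<inter> space (generated_sigma M N Z J) \<in> sets (generated_sigma M N Z J)"
    if "A \<in> sets N" for A
    using that assms(1) by (auto simp: generated_sigma_def space_measure_of_conv sets_measure_of_conv)
qed

lemma brownian_filtration_subalgebra:
  assumes "brownian_motion P W"
  shows "subalgebra P (brownian_filtration P W s)"
proof -
  have "subalgebra P (generated_sigma P borel W {0..s})"
    using assms by (intro generated_sigma_subalgebra) (auto simp: brownian_motion_def)
  then have "sets (generated_sigma P borel W {0..s}) \<union> null_sets P \<subseteq> sets P"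
    by (auto simp: subalgebra_def)
  then show ?thesis
    unfolding subalgebra_def brownian_filtration_def
    by (simp add: sets.sigma_sets_subset sets_measure_of_conv space_measure_of_conv)
qed

text \<open>A solution is adapted to the augmented Brownian filtration, which lies inside
  \<open>P\<close> because null sets are measurable; its paths stay in \<open>S\<close>, so the
  target can be cut down to \<open>S\<close>. This makes the transition law a genuine image
  measure.\<close>

lemma strong_solution_measurable:
  assumes "brownian_motion P W" "strong_solution P W a b \<theta> S z Z" "t \<ge> 0"
  shows "Z t \<in> P \<rightarrow>\<^sub>M state_borel S"
proof -
  have "Z t \<in> borel_measurable (brownian_filtration P W t)"
    using assms by (auto simp: strong_solution_def)
  then have "Z t \<in> borel_measurable P"
    using brownian_filtration_subalgebra[OF assms(1)] by (rule measurable_from_subalg[rotated])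
  then show ?thesis
    using assms by (auto intro!: measurable_restrict_space2 simp: strong_solution_def)
qed

section \<open>Integration against conditional laws\<close>

text \<open>The past enters as the identity map into \<open>F\<close>, so that \<open>h\<close> may depend on everything that is
  \<open>F\<close>-measurable.\<close>

lemma cond_law_nn_integral:
  assumes "prob_space D" and sub: "subalgebra D F"
    and Y[measurable]: "Y \<in> D \<rightarrow>\<^sub>M N"
    and Q: "Q \<in> F \<rightarrow>\<^sub>M prob_algebra N"
    and law: "has_cond_law D F N Y Q"
    and h[measurable]: "h \<in> borel_measurable (F \<Otimes>\<^sub>M N)"
  shows "(\<integral>\<^sup>+\<omega>. h (\<omega>, Y \<omega>) \<partial>D) = (\<integral>\<^sup>+\<omega>. \<integral>\<^sup>+z. h (\<omega>, z) \<partial>Q \<omega> \<partial>D)"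
proof -
  interpret prob_space D by fact
  interpret finite_measure_subalgebra D F by standard fact
  let ?R = "restr_to_subalg D F"
  have spF: "space F = space D" and setsF: "sets F \<subseteq> sets D"
    using sub by (auto simp: subalgebra_def)
  note [measurable_cong] = sets_restr_to_subalg[OF sub]
  have Qs[measurable]: "Q \<in> F \<rightarrow>\<^sub>M subprob_algebra N"
    using Q by (rule measurable_prob_algebraD)
  have idm[measurable]: "(\<lambda>\<omega>. \<omega>) \<in> D \<rightarrow>\<^sub>M F"
    using sub by (auto simp: measurable_def subalgebra_def)
  have QN: "sets (Q \<omega>) = sets N" "prob_space (Q \<omega>)" if "\<omega> \<in> space D" for \<omega>
    using measurable_space[OF Q, of \<omega>] that spF by (auto simp: space_prob_algebra)
  \<comment> \<open>This is the product of the point mass at \<omega> with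
    \<open>Q \<omega>\<close>. Mixing it over \<open>?R\<close>, which is \<open>D\<close> on the
    sigma-algebra of \<open>F\<close>, yields the joint law of the past and \<open>Y\<close> that
    \<open>Q\<close> predicts.\<close>
  define \<kappa> where "\<kappa> \<omega> = distr (Q \<omega>) (F \<Otimes>\<^sub>M N) (Pair \<omega>)" for \<omega>
  have \<kappa>[measurable]: "\<kappa> \<in> F \<rightarrow>\<^sub>M subprob_algebra (F \<Otimes>\<^sub>M N)"
    unfolding \<kappa>_def by (rule measurable_distr2[where M=N]) measurable
  have \<kappa>R: "\<kappa> \<in> ?R \<rightarrow>\<^sub>M subprob_algebra (F \<Otimes>\<^sub>M N)"
    by (rule measurable_in_subalg[OF sub \<kappa>])
  have ne: "space ?R \<noteq> {}"
    using not_empty by (simp add: space_restr_to_subalg)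
  have \<kappa>_int: "(\<integral>\<^sup>+p. k p \<partial>\<kappa> \<omega>) = (\<integral>\<^sup>+z. k (\<omega>, z) \<partial>Q \<omega>)"
    if [measurable]: "k \<in> borel_measurable (F \<Otimes>\<^sub>M N)" and w: "\<omega> \<in> space D" for k :: "_ \<Rightarrow> ennreal" and \<omega>
  proof -
    have [measurable_cong]: "sets (Q \<omega>) = sets N"
      using w by (rule QN)
    show ?thesis
      unfolding \<kappa>_def using w spF by (subst nn_integral_distr) auto
  qed
  have bind_int: "(\<integral>\<^sup>+p. k p \<partial>(?R \<bind> \<kappa>)) = (\<integral>\<^sup>+\<omega>. \<integral>\<^sup>+z. k (\<omega>, z) \<partial>Q \<omega> \<partial>D)"
    if k[measurable]: "k \<in> borel_measurable (F \<Otimes>\<^sub>M N)" for k :: "_ \<Rightarrow> ennreal"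
  proof -
    have "(\<integral>\<^sup>+p. k p \<partial>(?R \<bind> \<kappa>)) = (\<integral>\<^sup>+\<omega>. \<integral>\<^sup>+p. k p \<partial>\<kappa> \<omega> \<partial>?R)"
      using k \<kappa>R by (rule nn_integral_bind)
    also have "\<dots> = (\<integral>\<^sup>+\<omega>. \<integral>\<^sup>+p. k p \<partial>\<kappa> \<omega> \<partial>D)"
      by (rule nn_integral_subalgebra2[OF sub]) measurable
    also have "\<dots> = (\<integral>\<^sup>+\<omega>. \<integral>\<^sup>+z. k (\<omega>, z) \<partial>Q \<omega> \<partial>D)"
      using \<kappa>_int[OF k] by (rule nn_integral_cong)
    finally show ?thesis .
  qed
  have sets_bind: "sets (?R \<bind> \<kappa>) = sets (F \<Otimes>\<^sub>M N)"
    using ne by (intro sets_bind[OF sets_kernel[OF \<kappa>R]])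
  \<comment> \<open>Measurable rectangles form an intersection-stable generator and the total mass
    is finite, so it suffices to compare the actual and the predicted joint law on
    rectangles.\<close>
  have "distr D (F \<Otimes>\<^sub>M N) (\<lambda>\<omega>. (\<omega>, Y \<omega>)) = ?R \<bind> \<kappa>"
  proof (rule measure_eqI_generator_eq[OF Int_stable_pair_measure_generator[of F N]])
    show "{a \<times> b |a b. a \<in> sets F \<and> b \<in> sets N} \<subseteq> Pow (space F \<times> space N)"
      by (rule pair_measure_closed)
    show "sets (distr D (F \<Otimes>\<^sub>M N) (\<lambda>\<omega>. (\<omega>, Y \<omega>)))
        = sigma_sets (space F \<times> space N) {a \<times> b |a b. a \<in> sets F \<and> b \<in> sets N}"
      by (simp add: sets_pair_measure)
    show "sets (?R \<bind> \<kappa>) = sigma_sets (space F \<times> space N) {a \<times> b |a b. a \<in> sets F \<and> b \<in> sets N}"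
      by (simp add: sets_bind sets_pair_measure)
    show "range (\<lambda>_::nat. space F \<times> space N) \<subseteq> {a \<times> b |a b. a \<in> sets F \<and> b \<in> sets N}"
      by auto
    interpret J: prob_space "distr D (F \<Otimes>\<^sub>M N) (\<lambda>\<omega>. (\<omega>, Y \<omega>))"
      by (rule prob_space_distr) measurable
    show "emeasure (distr D (F \<Otimes>\<^sub>M N) (\<lambda>\<omega>. (\<omega>, Y \<omega>))) (space F \<times> space N) \<noteq> \<infinity>" for i :: nat
      by simp
    fix C assume "C \<in> {a \<times> b |a b. a \<in> sets F \<and> b \<in> sets N}"
    then obtain A B where C: "C = A \<times> B" and [measurable]: "A \<in> sets F" "B \<in> sets N" by auto
    have AD[measurable]: "A \<in> sets D" using \<open>A \<in> sets F\<close> setsF by auto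
    let ?I = "indicator (Y -` B \<inter> space D) :: _ \<Rightarrow> real"
    have YB[measurable]: "Y -` B \<inter> space D \<in> sets D" by measurable
    have intI: "integrable D ?I"
      using YB by (rule integrable_real_indicator) (simp add: less_top[symmetric])
    \<comment> \<open>Since \<open>A\<close> belongs to the past, the indicator of the event that
      \<open>Y\<close> lies in \<open>B\<close> may be replaced under the integral over
      \<open>A\<close> by its conditional expectation, and this by \<open>Q \<omega>\<close> of
      \<open>B\<close>, almost surely.\<close>
    have "measure D (A \<inter> Y -` B \<inter> space D) = (\<integral>\<omega>\<in>A. ?I \<omega> \<partial>D)"
      by (simp add: set_lebesgue_integral_def indicator_inter_arith[symmetric] Int_assoc)
    also have "\<dots> = (\<integral>\<omega>\<in>A. real_cond_exp D F ?I \<omega> \<partial>D)"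
      using intI by (rule real_cond_exp_intA) fact
    also have "\<dots> = (\<integral>\<omega>\<in>A. measure (Q \<omega>) B \<partial>D)"
      using law \<open>B \<in> sets N\<close> unfolding set_lebesgue_integral_def has_cond_law_def
      by (intro integral_cong_AE) (auto elim!: ballE[where x=B])
    finally have m: "measure D (A \<inter> Y -` B \<inter> space D) = (\<integral>\<omega>. indicator A \<omega> * measure (Q \<omega>) B \<partial>D)"
      by (simp add: set_lebesgue_integral_def)
    have mQ[measurable]: "(\<lambda>\<omega>. measure (Q \<omega>) B) \<in> borel_measurable F" by measurable
    have mQD: "(\<lambda>\<omega>. measure (Q \<omega>) B) \<in> borel_measurable D"
      by (rule measurable_from_subalg[OF sub mQ])
    have "emeasure (distr D (F \<Otimes>\<^sub>M N) (\<lambda>\<omega>. (\<omega>, Y \<omega>))) C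
        = emeasure D (A \<inter> Y -` B \<inter> space D)"
      unfolding C by (subst emeasure_distr) (auto intro!: arg_cong[where f="emeasure D"])
    also have "\<dots> = ennreal (\<integral>\<omega>. indicator A \<omega> * measure (Q \<omega>) B \<partial>D)"
      by (simp add: emeasure_eq_measure m)
    also have "\<dots> = (\<integral>\<^sup>+\<omega>. ennreal (indicator A \<omega> * measure (Q \<omega>) B) \<partial>D)"
    proof (rule nn_integral_eq_integral[symmetric])
      show "integrable D (\<lambda>\<omega>. indicator A \<omega> * measure (Q \<omega>) B)"
        using mQD QN by (intro integrable_const_bound[where B=1])
          (auto simp: indicator_def intro!: prob_space.prob_le_1)
    qed simp
    also have "\<dots> = (\<integral>\<^sup>+\<omega>. \<integral>\<^sup>+z. indicator C (\<omega>, z) \<partial>Q \<omega> \<partial>D)"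
    proof (rule nn_integral_cong)
      fix \<omega> assume w: "\<omega> \<in> space D"
      interpret Qw: prob_space "Q \<omega>" using w by (rule QN)
      have [measurable]: "B \<in> sets (Q \<omega>)" using QN[OF w] by simp
      show "ennreal (indicator A \<omega> * measure (Q \<omega>) B) = (\<integral>\<^sup>+z. indicator C (\<omega>, z) \<partial>Q \<omega>)"
        unfolding C indicator_times
        by (simp add: nn_integral_cmult ennreal_mult' Qw.emeasure_eq_measure)
           (auto simp: indicator_def)
    qed
    also have "\<dots> = emeasure (?R \<bind> \<kappa>) C"
      using bind_int[of "indicator C"] unfolding C by (simp add: sets_bind)
    finally show "emeasure (distr D (F \<Otimes>\<^sub>M N) (\<lambda>\<omega>. (\<omega>, Y \<omega>))) C = emeasure (?R \<bind> \<kappa>) C" .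
  qed auto
  then have "(\<integral>\<^sup>+p. h p \<partial>distr D (F \<Otimes>\<^sub>M N) (\<lambda>\<omega>. (\<omega>, Y \<omega>))) = (\<integral>\<^sup>+\<omega>. \<integral>\<^sup>+z. h (\<omega>, z) \<partial>Q \<omega> \<partial>D)"
    by (simp add: bind_int)
  then show ?thesis
    by (simp add: nn_integral_distr)
qed

text \<open>Given the past, \<open>c\<close> and \<open>m\<close> are constants and only
  \<open>f (Y \<omega>)\<close> is random, so the weight can be pulled out. Both sides are
  nonnegative integrals, hence infinite values are allowed. With \<open>m\<close> the conditional
  mean, the inner integral is a conditional variance.\<close>

lemma cond_law_second_moment:
  assumes "prob_space D" and sub: "subalgebra D F"
    and Y: "Y \<in> D \<rightarrow>\<^sub>M N"
    and Q: "Q \<in> F \<rightarrow>\<^sub>M prob_algebra N"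
    and law: "has_cond_law D F N Y Q"
    and [measurable]: "c \<in> borel_measurable F" "m \<in> borel_measurable F" "f \<in> borel_measurable N"
  shows "(\<integral>\<^sup>+\<omega>. ennreal ((c \<omega> * (m \<omega> - f (Y \<omega>)))\<^sup>2) \<partial>D)
      = (\<integral>\<^sup>+\<omega>. ennreal ((c \<omega>)\<^sup>2) * (\<integral>\<^sup>+z. ennreal ((m \<omega> - f z)\<^sup>2) \<partial>Q \<omega>) \<partial>D)"
proof -
  have "(\<integral>\<^sup>+\<omega>. ennreal ((c \<omega> * (m \<omega> - f (Y \<omega>)))\<^sup>2) \<partial>D)
      = (\<integral>\<^sup>+\<omega>. \<integral>\<^sup>+z. ennreal ((c \<omega> * (m \<omega> - f z))\<^sup>2) \<partial>Q \<omega> \<partial>D)"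
    using cond_law_nn_integral[OF assms(1-5), of "\<lambda>(\<omega>, z). ennreal ((c \<omega> * (m \<omega> - f z))\<^sup>2)"] by simp
  also have "\<dots> = (\<integral>\<^sup>+\<omega>. ennreal ((c \<omega>)\<^sup>2) * (\<integral>\<^sup>+z. ennreal ((m \<omega> - f z)\<^sup>2) \<partial>Q \<omega>) \<partial>D)"
  proof (rule nn_integral_cong)
    fix \<omega> assume "\<omega> \<in> space D"
    then have [measurable_cong]: "sets (Q \<omega>) = sets N"
      using measurable_space[OF Q, of \<omega>] sub by (auto simp: space_prob_algebra subalgebra_def)
    show "(\<integral>\<^sup>+z. ennreal ((c \<omega> * (m \<omega> - f z))\<^sup>2) \<partial>Q \<omega>)
        = ennreal ((c \<omega>)\<^sup>2) * (\<integral>\<^sup>+z. ennreal ((m \<omega> - f z)\<^sup>2) \<partial>Q \<omega>)"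
      by (simp add: power_mult_distrib ennreal_mult nn_integral_cmult)
  qed
  finally show ?thesis .
qed

text \<open>Comparing the nonnegative integrals of the positive and negative parts avoids assuming that
  \<open>f \<circ> Y\<close> is integrable, which need not hold for Markov chain data.\<close>

lemma cond_law_noise_mean_zero:
  fixes c :: "'d \<Rightarrow> real"
  assumes "prob_space D" and sub: "subalgebra D F"
    and Y[measurable]: "Y \<in> D \<rightarrow>\<^sub>M N"
    and Q: "Q \<in> F \<rightarrow>\<^sub>M prob_algebra N"
    and law: "has_cond_law D F N Y Q"
    and c[measurable]: "c \<in> borel_measurable F" and f[measurable]: "f \<in> borel_measurable N"
    and int: "\<And>\<omega>. \<omega> \<in> space D \<Longrightarrow> integrable (Q \<omega>) f"
  shows "(\<integral>\<omega>. c \<omega> * ((\<integral>z. f z \<partial>Q \<omega>) - f (Y \<omega>)) \<partial>D) = 0"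
proof -
  define m where "m \<omega> = (\<integral>z. f z \<partial>Q \<omega>)" for \<omega>
  have [measurable]: "Q \<in> F \<rightarrow>\<^sub>M subprob_algebra N"
    using Q by (rule measurable_prob_algebraD)
  have m[measurable]: "m \<in> borel_measurable F"
    unfolding m_def by measurable
  let ?h = "\<lambda>\<omega> z. c \<omega> * (m \<omega> - f z)"
  have *: "(\<integral>\<^sup>+\<omega>. ennreal (?h \<omega> (Y \<omega>)) \<partial>D) = (\<integral>\<^sup>+\<omega>. ennreal (- ?h \<omega> (Y \<omega>)) \<partial>D)"
  proof -
    have "(\<integral>\<^sup>+\<omega>. ennreal (?h \<omega> (Y \<omega>)) \<partial>D) = (\<integral>\<^sup>+\<omega>. \<integral>\<^sup>+z. ennreal (?h \<omega> z) \<partial>Q \<omega> \<partial>D)"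
      using cond_law_nn_integral[OF assms(1-5), of "\<lambda>(\<omega>, z). ennreal (?h \<omega> z)"] by simp
    also have "\<dots> = (\<integral>\<^sup>+\<omega>. \<integral>\<^sup>+z. ennreal (- ?h \<omega> z) \<partial>Q \<omega> \<partial>D)"
    proof (rule nn_integral_cong)
      fix \<omega> assume w: "\<omega> \<in> space D"
      interpret Qw: prob_space "Q \<omega>"
        using measurable_space[OF Q, of \<omega>] sub w by (auto simp: space_prob_algebra subalgebra_def)
      have i: "integrable (Q \<omega>) (?h \<omega>)"
        using int[OF w] by simp
      have "(\<integral>z. ?h \<omega> z \<partial>Q \<omega>) = 0"
        unfolding integral_mult_right_zero using int[OF w] by (simp add: m_def Qw.prob_space)
      then have eq: "enn2real (\<integral>\<^sup>+z. ennreal (?h \<omega> z) \<partial>Q \<omega>) = enn2real (\<integral>\<^sup>+z. ennreal (- ?h \<omega> z) \<partial>Q \<omega>)"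
        using real_lebesgue_integral_def[OF i] by linarith
      \<comment> \<open>Finiteness is essential here: \<open>enn2real\<close> sends infinity to 0,
        so equality of the real values alone would not give equality of the two parts.\<close>
      have "(\<integral>\<^sup>+z. ennreal (?h \<omega> z) \<partial>Q \<omega>) < \<infinity>" "(\<integral>\<^sup>+z. ennreal (- ?h \<omega> z) \<partial>Q \<omega>) < \<infinity>"
        using i unfolding real_integrable_def by (simp_all add: less_top)
      with eq show "(\<integral>\<^sup>+z. ennreal (?h \<omega> z) \<partial>Q \<omega>) = (\<integral>\<^sup>+z. ennreal (- ?h \<omega> z) \<partial>Q \<omega>)"
        by (metis ennreal_enn2real infinity_ennreal_def)
    qed
    also have "\<dots> = (\<integral>\<^sup>+\<omega>. ennreal (- ?h \<omega> (Y \<omega>)) \<partial>D)"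
      using cond_law_nn_integral[OF assms(1-5), of "\<lambda>(\<omega>, z). ennreal (- ?h \<omega> z)"] by simp
    finally show ?thesis .
  qed
  \<comment> \<open>If the noise is integrable, its integral is the difference of the two equal
    parts; otherwise the Bochner integral is 0 by convention.\<close>
  have "(\<integral>\<omega>. ?h \<omega> (Y \<omega>) \<partial>D) = 0"
  proof (cases "integrable D (\<lambda>\<omega>. ?h \<omega> (Y \<omega>))")
    case True
    then show ?thesis
      using * by (simp add: real_lebesgue_integral_def)
  qed (rule not_integrable_integral_eq)
  then show ?thesis
    by (simp add: m_def)
qed

section \<open>Averages of orthogonal square-integrable variables\<close>

lemma integrable_mult_of_squares:
  fixes f g :: "'a \<Rightarrow> real"
  assumes [measurable]: "f \<in> borel_measurable M" "g \<in> borel_measurable M"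
    and "integrable M (\<lambda>x. (f x)\<^sup>2)" "integrable M (\<lambda>x. (g x)\<^sup>2)"
  shows "integrable M (\<lambda>x. f x * g x)"
proof (rule Bochner_Integration.integrable_bound)
  show "integrable M (\<lambda>x. (f x)\<^sup>2 + (g x)\<^sup>2)"
    using assms by simp
  have "\<bar>f x\<bar> * \<bar>g x\<bar> \<le> (f x)\<^sup>2 + (g x)\<^sup>2" for x
    using sum_squares_bound[of "\<bar>f x\<bar>" "\<bar>g x\<bar>"] mult_nonneg_nonneg[of "\<bar>f x\<bar>" "\<bar>g x\<bar>"]
    unfolding power2_abs by linarith
  then show "AE x in M. norm (f x * g x) \<le> norm ((f x)\<^sup>2 + (g x)\<^sup>2)"
    by (simp add: abs_mult)
qed measurable

text \<open>Expanding the square of the sum gives T^2 products. Those off the diagonal integrate to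
  zero and the T on the diagonal contribute at most \<open>C\<close> each; the prefactor 1/T^2
  leaves \<open>C / T\<close>.\<close>

lemma orthogonal_mean_square:
  fixes Z :: "nat \<Rightarrow> 'd \<Rightarrow> real"
  assumes T: "T \<ge> 1" and C: "C \<ge> 0"
    and [measurable]: "\<And>k. k \<in> {1..T} \<Longrightarrow> Z k \<in> borel_measurable D"
    and sq: "\<And>k. k \<in> {1..T} \<Longrightarrow> (\<integral>\<^sup>+\<omega>. ennreal ((Z k \<omega>)\<^sup>2) \<partial>D) \<le> ennreal C"
    and orth: "\<And>k l. k \<in> {1..T} \<Longrightarrow> l \<in> {1..T} \<Longrightarrow> k < l \<Longrightarrow> (\<integral>\<omega>. Z k \<omega> * Z l \<omega> \<partial>D) = 0"
  shows "(\<integral>\<^sup>+\<omega>. ennreal ((1 / real T * (\<Sum>k=1..T. Z k \<omega>))\<^sup>2) \<partial>D) \<le> ennreal (C / real T)"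
proof -
  \<comment> \<open>A vanishing Bochner integral in \<open>orth\<close> says nothing about a
    non-integrable product; the bounded second moments make all products integrable and also justify
    exchanging sum and integral.\<close>
  have i: "integrable D (\<lambda>\<omega>. (Z k \<omega>)\<^sup>2)" if "k \<in> {1..T}" for k
    using sq[OF that] that
    by (intro integrableI_bounded) (auto simp: le_less_trans)
  have ij: "integrable D (\<lambda>\<omega>. Z k \<omega> * Z l \<omega>)" if "k \<in> {1..T}" "l \<in> {1..T}" for k l
    using that i by (intro integrable_mult_of_squares) auto
  have ik: "(\<integral>\<omega>. (Z k \<omega>)\<^sup>2 \<partial>D) \<le> C" if "k \<in> {1..T}" for k
    using sq[OF that] nn_integral_eq_integral[OF i[OF that]] C by simp
  have orth': "(\<integral>\<omega>. Z k \<omega> * Z l \<omega> \<partial>D) = 0" if "k \<in> {1..T}" "l \<in> {1..T}" "k \<noteq> l" for k l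
    using orth[of k l] orth[of l k] that by (cases "k < l") (auto simp: mult.commute)
  have eq: "(1 / real T * (\<Sum>k=1..T. Z k \<omega>))\<^sup>2 = (1 / (real T)\<^sup>2) * (\<Sum>k=1..T. \<Sum>l=1..T. Z k \<omega> * Z l \<omega>)" for \<omega>
    by (simp add: power2_eq_square sum_product)
  have I: "integrable D (\<lambda>\<omega>. (1 / real T * (\<Sum>k=1..T. Z k \<omega>))\<^sup>2)"
    unfolding eq using ij by (intro integrable_mult_right Bochner_Integration.integrable_sum) auto
  have "(\<integral>\<omega>. (1 / real T * (\<Sum>k=1..T. Z k \<omega>))\<^sup>2 \<partial>D)
      = (1 / (real T)\<^sup>2) * (\<Sum>k=1..T. \<Sum>l=1..T. \<integral>\<omega>. Z k \<omega> * Z l \<omega> \<partial>D)"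
  proof -
    have "(\<integral>\<omega>. (\<Sum>k=1..T. \<Sum>l=1..T. Z k \<omega> * Z l \<omega>) \<partial>D)
        = (\<Sum>k=1..T. \<integral>\<omega>. (\<Sum>l=1..T. Z k \<omega> * Z l \<omega>) \<partial>D)"
      using ij by (intro Bochner_Integration.integral_sum Bochner_Integration.integrable_sum)
    also have "\<dots> = (\<Sum>k=1..T. \<Sum>l=1..T. \<integral>\<omega>. Z k \<omega> * Z l \<omega> \<partial>D)"
      using ij by (intro sum.cong refl Bochner_Integration.integral_sum)
    finally show ?thesis
      unfolding eq integral_mult_right_zero by (rule arg_cong)
  qed
  also have "(\<Sum>k=1..T. \<Sum>l=1..T. \<integral>\<omega>. Z k \<omega> * Z l \<omega> \<partial>D)
      = (\<Sum>k=1..T. \<Sum>l=1..T. if l = k then \<integral>\<omega>. (Z k \<omega>)\<^sup>2 \<partial>D else 0)"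
    using orth' by (intro sum.cong) (auto simp: power2_eq_square)
  also have "\<dots> = (\<Sum>k=1..T. \<integral>\<omega>. (Z k \<omega>)\<^sup>2 \<partial>D)"
    by simp
  also have "\<dots> \<le> real T * C"
    using sum_bounded_above[of "{1..T}" "\<lambda>k. \<integral>\<omega>. (Z k \<omega>)\<^sup>2 \<partial>D" C] ik by simp
  finally have "(\<integral>\<omega>. (1 / real T * (\<Sum>k=1..T. Z k \<omega>))\<^sup>2 \<partial>D) \<le> C / real T"
    using T by (simp add: field_simps power2_eq_square)
  then show ?thesis
    by (subst nn_integral_eq_integral[OF I]) (auto intro: ennreal_leI)
qed

section \<open>Frobenius norm and measurability of the matrix inverse\<close>

lemma frob_norm_nonneg: "frob_norm A \<ge> 0"
  unfolding frob_norm_def by (intro real_sqrt_ge_zero sum_nonneg) auto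

lemma frob_norm_square: "(frob_norm A)\<^sup>2 = (\<Sum>i\<in>UNIV. \<Sum>j\<in>UNIV. (A $ i $ j)\<^sup>2)"
  unfolding frob_norm_def by (subst real_sqrt_pow2) (auto intro!: sum_nonneg)

text \<open>Cauchy-Schwarz bounds each squared entry of the product by a factor depending only on
  its row times one depending only on its column, so the double sum splits.\<close>

lemma frob_norm_matrix_mult: "frob_norm (A ** B) \<le> frob_norm A * frob_norm B"
proof (rule power2_le_imp_le)
  have "(frob_norm (A ** B))\<^sup>2 = (\<Sum>i\<in>UNIV. \<Sum>j\<in>UNIV. (\<Sum>k\<in>UNIV. A $ i $ k * B $ k $ j)\<^sup>2)"
    by (simp add: frob_norm_square matrix_matrix_mult_def)
  also have "\<dots> \<le> (\<Sum>i\<in>UNIV. \<Sum>j\<in>UNIV. (\<Sum>k\<in>UNIV. (A $ i $ k)\<^sup>2) * (\<Sum>k\<in>UNIV. (B $ k $ j)\<^sup>2))"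
    by (intro sum_mono Cauchy_Schwarz_ineq_sum)
  also have "\<dots> = (\<Sum>i\<in>UNIV. \<Sum>k\<in>UNIV. (A $ i $ k)\<^sup>2) * (\<Sum>j\<in>UNIV. \<Sum>k\<in>UNIV. (B $ k $ j)\<^sup>2)"
    by (simp add: sum_product)
  also have "(\<Sum>j\<in>UNIV. \<Sum>k\<in>UNIV. (B $ k $ j)\<^sup>2) = (frob_norm B)\<^sup>2"
    unfolding frob_norm_square by (rule sum.swap)
  finally show "(frob_norm (A ** B))\<^sup>2 \<le> (frob_norm A * frob_norm B)\<^sup>2"
    by (simp add: power_mult_distrib frob_norm_square[of A])
qed (simp add: frob_norm_nonneg)

lemma borel_measurable_frob_norm:
  assumes "\<And>i j. (\<lambda>\<omega>. A \<omega> $ i $ j) \<in> borel_measurable M"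
  shows "(\<lambda>\<omega>. frob_norm (A \<omega>)) \<in> borel_measurable M"
  using assms unfolding frob_norm_def by measurable

lemma borel_measurable_det:
  fixes A :: "'a \<Rightarrow> real^'n^'n"
  assumes "\<And>i j. (\<lambda>\<omega>. A \<omega> $ i $ j) \<in> borel_measurable M"
  shows "(\<lambda>\<omega>. det (A \<omega>)) \<in> borel_measurable M"
  using assms unfolding det_def by measurable

text \<open>Column \<open>l\<close> of the inverse solves the linear system with right-hand side
  \<open>axis l 1\<close>, to which Cramer's rule applies. The resulting quotient of determinants is
  visibly measurable in the entries.\<close>

lemma matrix_inv_cramer:
  fixes A :: "real^'n^'n"
  assumes "det A \<noteq> 0"
  shows "matrix_inv A $ k $ l = det (\<chi> i j. if j = k then axis l 1 $ i else A $ i $ j) / det A"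
proof -
  have "invertible A" using assms by (simp add: invertible_det_nz)
  then have "A ** matrix_inv A = mat 1"
    unfolding invertible_def matrix_inv_def by (rule someI2_ex) simp
  then have "A *v column l (matrix_inv A) = axis l 1"
    by (metis matrix_vector_mul_assoc matrix_vector_mul_lid matrix_vector_mult_basis)
  then have "column l (matrix_inv A) = (\<chi> k. det (\<chi> i j. if j = k then axis l 1 $ i else A $ i $ j) / det A)"
    using cramer[OF assms] by blast
  then show ?thesis
    by (simp add: column_def vec_eq_iff)
qed

lemma borel_measurable_matrix_inv:
  fixes A :: "'a \<Rightarrow> real^'n^'n"
  assumes A[measurable]: "\<And>i j. (\<lambda>\<omega>. A \<omega> $ i $ j) \<in> borel_measurable M"
  shows "(\<lambda>\<omega>. matrix_inv (A \<omega>) $ k $ l) \<in> borel_measurable M"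
proof -
  \<comment> \<open>On singular matrices \<open>matrix_inv\<close> is a choice from the empty predicate, hence constant.\<close>
  define c where "c = (SOME B::real^'n^'n. False) $ k $ l"
  have singular: "matrix_inv B $ k $ l = c" if "det B = 0" for B :: "real^'n^'n"
  proof -
    have "(\<lambda>B'. B ** B' = mat 1 \<and> B' ** B = mat 1) = (\<lambda>_. False)"
      using that invertible_det_nz[of B] unfolding invertible_def by blast
    then show ?thesis
      unfolding c_def matrix_inv_def by (simp only:)
  qed
  have [measurable]: "(\<lambda>\<omega>. det (A \<omega>)) \<in> borel_measurable M"
    using A by (rule borel_measurable_det)
  have [measurable]: "(\<lambda>\<omega>. det (\<chi> i j. if j = k then axis l 1 $ i else A \<omega> $ i $ j)) \<in> borel_measurable M"
    by (rule borel_measurable_det) simp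
  have "(\<lambda>\<omega>. matrix_inv (A \<omega>) $ k $ l) = (\<lambda>\<omega>. if det (A \<omega>) = 0 then c
      else det (\<chi> i j. if j = k then axis l 1 $ i else A \<omega> $ i $ j) / det (A \<omega>))"
    by (auto simp: singular matrix_inv_cramer)
  then show ?thesis
    by simp
qed

text \<open>Submultiplicativity holds pointwise; the Cauchy-Schwarz inequality for integrals then
  separates the two random factors, which may be dependent.\<close>

lemma nn_integral_frob_norm_mult_le:
  fixes A :: "'a \<Rightarrow> real^'n^'m" and B :: "'a \<Rightarrow> real^'k^'n"
  assumes A: "\<And>i j. (\<lambda>\<omega>. A \<omega> $ i $ j) \<in> borel_measurable M"
    and B: "\<And>i j. (\<lambda>\<omega>. B \<omega> $ i $ j) \<in> borel_measurable M"
    and a: "(\<integral>\<^sup>+\<omega>. ennreal ((frob_norm (A \<omega>))\<^sup>2) \<partial>M) \<le> ennreal a" "a \<ge> 0"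
    and b: "(\<integral>\<^sup>+\<omega>. ennreal ((frob_norm (B \<omega>))\<^sup>2) \<partial>M) \<le> ennreal b" "b \<ge> 0"
  shows "(\<integral>\<^sup>+\<omega>. ennreal (frob_norm (A \<omega> ** B \<omega>)) \<partial>M) \<le> ennreal (sqrt (a * b))"
proof -
  have [measurable]: "(\<lambda>\<omega>. frob_norm (A \<omega>)) \<in> borel_measurable M" "(\<lambda>\<omega>. frob_norm (B \<omega>)) \<in> borel_measurable M"
    using A B by (auto intro: borel_measurable_frob_norm)
  let ?I = "\<integral>\<^sup>+\<omega>. ennreal (frob_norm (A \<omega>)) * ennreal (frob_norm (B \<omega>)) \<partial>M"
  have "?I\<^sup>2 \<le> (\<integral>\<^sup>+\<omega>. (ennreal (frob_norm (A \<omega>)))\<^sup>2 \<partial>M) * (\<integral>\<^sup>+\<omega>. (ennreal (frob_norm (B \<omega>)))\<^sup>2 \<partial>M)"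
    by (rule Cauchy_Schwarz_nn_integral) measurable
  also have "\<dots> \<le> ennreal a * ennreal b"
    using a b by (intro mult_mono) (simp_all add: ennreal_power frob_norm_nonneg)
  also have "\<dots> = (ennreal (sqrt (a * b)))\<^sup>2"
    using a b by (simp add: ennreal_power flip: ennreal_mult)
  \<comment> \<open>Square roots are taken by cases: \<open>?I\<close> cannot be infinite because
    its square has a finite bound, and for finite values squaring is monotone.\<close>
  finally have "?I \<le> ennreal (sqrt (a * b))"
    using a(2) b(2) by (cases ?I) (simp_all add: ennreal_power power_mono_iff top_power_ennreal top_unique flip: power_mono_iff[of _ "sqrt (a * b)" 2])
  moreover have "(\<integral>\<^sup>+\<omega>. ennreal (frob_norm (A \<omega> ** B \<omega>)) \<partial>M) \<le> ?I"
    by (intro nn_integral_mono)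
      (auto simp: frob_norm_nonneg frob_norm_matrix_mult simp flip: ennreal_mult intro!: ennreal_leI)
  ultimately show ?thesis by simp
qed


section \<open>Noise terms driven by the transition kernel\<close>

text \<open>The link from the SDE to the samples: the first assumption turns \<open>koopman\<close>
  and \<open>transition_variance\<close> into integrals against the transition law, and the second
  lets the law at a random state serve as a kernel from the past.\<close>

locale transition_kernel =
  fixes P :: "'w measure" and S :: "real set" and X :: "real \<Rightarrow> real \<Rightarrow> 'w \<Rightarrow> real" and t :: real
  assumes flow_measurable: "\<And>z. z \<in> S \<Longrightarrow> X t z \<in> P \<rightarrow>\<^sub>M state_borel S"
    and kernel_measurable: "transition_law P S X t \<in> state_borel S \<rightarrow>\<^sub>M prob_algebra (state_borel S)"
begin

lemma koopman_domain_measurable: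
  "f \<in> koopman_domain P S X t \<Longrightarrow> f \<in> borel_measurable (state_borel S)"
  by (simp add: koopman_domain_def)

lemma integrable_transition_law:
  assumes "f \<in> koopman_domain P S X t" "z \<in> S"
  shows "integrable (transition_law P S X t z) f"
  using assms flow_measurable[OF assms(2)]
  by (simp add: koopman_domain_def transition_law_def integrable_distr_eq)

lemma koopman_eq_integral:
  assumes "f \<in> koopman_domain P S X t" "z \<in> S"
  shows "koopman P X t f z = (\<integral>w. f w \<partial>transition_law P S X t z)"
  unfolding koopman_def transition_law_def
  using flow_measurable[OF assms(2)] koopman_domain_measurable[OF assms(1)]
  by (rule integral_distr[symmetric])

lemma transition_variance_eq:
  assumes "f \<in> koopman_domain P S X t" "z \<in> S"
  shows "transition_variance P X t f z
    = (\<integral>\<^sup>+w. ennreal ((koopman P X t f z - f w)\<^sup>2) \<partial>transition_law P S X t z)"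
proof -
  have [measurable]: "X t z \<in> P \<rightarrow>\<^sub>M state_borel S" "f \<in> borel_measurable (state_borel S)"
    using assms by (auto intro: flow_measurable koopman_domain_measurable)
  show ?thesis
    unfolding transition_variance_def transition_law_def
    by (simp add: nn_integral_distr power2_commute)
qed

lemma measurable_koopman:
  assumes "f \<in> koopman_domain P S X t"
  shows "koopman P X t f \<in> borel_measurable (state_borel S)"
proof -
  have [measurable]: "transition_law P S X t \<in> state_borel S \<rightarrow>\<^sub>M subprob_algebra (state_borel S)"
    using kernel_measurable by (rule measurable_prob_algebraD)
  have [measurable]: "f \<in> borel_measurable (state_borel S)"
    using assms by (rule koopman_domain_measurable)
  have "(\<lambda>z. \<integral>w. f w \<partial>transition_law P S X t z) \<in> borel_measurable (state_borel S)"
    by measurable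
  then show ?thesis
    by (rule measurable_cong[THEN iffD2, rotated])
      (simp add: koopman_eq_integral[OF assms] space_restrict_space)
qed

text \<open>The value of \<open>koopman\<close> at the current state is the mean of \<open>f\<close>
  under the conditional law of \<open>Y\<close>, so the inner second moment is the variance.
  \<open>F\<close> stays general because it is generated by one state in independent sampling and by
  the whole history in Markov sampling.\<close>

lemma noise_second_moment:
  assumes "prob_space D" "subalgebra D F" "Y \<in> D \<rightarrow>\<^sub>M state_borel S"
    and x[measurable]: "x \<in> F \<rightarrow>\<^sub>M state_borel S"
    and law: "has_cond_law D F (state_borel S) Y (\<lambda>\<omega>. transition_law P S X t (x \<omega>))"
    and f: "f \<in> koopman_domain P S X t" and [measurable]: "g \<in> borel_measurable (state_borel S)"
  shows "(\<integral>\<^sup>+\<omega>. ennreal (((koopman P X t f (x \<omega>) - f (Y \<omega>)) * g (x \<omega>))\<^sup>2) \<partial>D)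
    = (\<integral>\<^sup>+\<omega>. ennreal ((g (x \<omega>))\<^sup>2) * transition_variance P X t f (x \<omega>) \<partial>D)"
proof -
  have [measurable]: "f \<in> borel_measurable (state_borel S)" "koopman P X t f \<in> borel_measurable (state_borel S)"
    using f by (auto intro: koopman_domain_measurable measurable_koopman)
  have xS: "x \<omega> \<in> S" if "\<omega> \<in> space D" for \<omega>
    using measurable_space[OF x, of \<omega>] that assms(2) by (simp add: subalgebra_def space_restrict_space)
  have Q: "(\<lambda>\<omega>. transition_law P S X t (x \<omega>)) \<in> F \<rightarrow>\<^sub>M prob_algebra (state_borel S)"
    using x kernel_measurable by (rule measurable_compose)
  have "(\<integral>\<^sup>+\<omega>. ennreal ((g (x \<omega>) * (koopman P X t f (x \<omega>) - f (Y \<omega>)))\<^sup>2) \<partial>D)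
    = (\<integral>\<^sup>+\<omega>. ennreal ((g (x \<omega>))\<^sup>2)
        * (\<integral>\<^sup>+z. ennreal ((koopman P X t f (x \<omega>) - f z)\<^sup>2) \<partial>transition_law P S X t (x \<omega>)) \<partial>D)"
    by (rule cond_law_second_moment[OF assms(1-3) Q law]) measurable
  also have "\<dots> = (\<integral>\<^sup>+\<omega>. ennreal ((g (x \<omega>))\<^sup>2) * transition_variance P X t f (x \<omega>) \<partial>D)"
    by (intro nn_integral_cong) (simp add: transition_variance_eq[OF f xS])
  finally show ?thesis
    by (simp add: mult.commute)
qed

text \<open>The weight \<open>c\<close> may be any function of the past. Independent sampling takes
  \<open>g\<close> at the current state; Markov sampling multiplies this by an earlier noise term,
  which gives orthogonality.\<close>

lemma noise_mean_zero:
  assumes "prob_space D" "subalgebra D F" "Y \<in> D \<rightarrow>\<^sub>M state_borel S"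
    and x: "x \<in> F \<rightarrow>\<^sub>M state_borel S"
    and law: "has_cond_law D F (state_borel S) Y (\<lambda>\<omega>. transition_law P S X t (x \<omega>))"
    and f: "f \<in> koopman_domain P S X t" and c: "c \<in> borel_measurable F"
  shows "(\<integral>\<omega>. c \<omega> * (koopman P X t f (x \<omega>) - f (Y \<omega>)) \<partial>D) = 0"
proof -
  have xS: "x \<omega> \<in> S" if "\<omega> \<in> space D" for \<omega>
    using measurable_space[OF x, of \<omega>] that assms(2) by (simp add: subalgebra_def space_restrict_space)
  have Q: "(\<lambda>\<omega>. transition_law P S X t (x \<omega>)) \<in> F \<rightarrow>\<^sub>M prob_algebra (state_borel S)"
    using x kernel_measurable by (rule measurable_compose)
  have "(\<integral>\<omega>. c \<omega> * (koopman P X t f (x \<omega>) - f (Y \<omega>)) \<partial>D)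
    = (\<integral>\<omega>. c \<omega> * ((\<integral>z. f z \<partial>transition_law P S X t (x \<omega>)) - f (Y \<omega>)) \<partial>D)"
    by (intro Bochner_Integration.integral_cong) (simp_all add: koopman_eq_integral[OF f xS])
  also have "\<dots> = 0"
    using f xS by (intro cond_law_noise_mean_zero[OF assms(1-3) Q law c])
      (auto intro: koopman_domain_measurable integrable_transition_law)
  finally show ?thesis .
qed

section \<open>Mean square of the averaged noise in the two sampling schemes\<close>

text \<open>Independent integrable variables have a product whose expectation factors, and each
  factor is zero, hence orthogonality. As every state has law \<mu>, the second moments become the
  \<mu>-integral that is assumed bounded.\<close>

lemma independent_noise_mean_square:
  assumes T: "T \<ge> 1" and C: "C \<ge> 0"
    and data: "independent_sampling D S \<mu> (transition_law P S X t) T x y"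
    and f: "f \<in> koopman_domain P S X t" and g: "g \<in> koopman_domain P S X t"
    and bound: "(\<integral>\<^sup>+z. ennreal ((g z)\<^sup>2) * transition_variance P X t f z \<partial>\<mu>) \<le> ennreal C"
  shows "(\<integral>\<^sup>+\<omega>. ennreal ((1 / real T * (\<Sum>k=1..T. (koopman P X t f (x k \<omega>) - f (y k \<omega>)) * g (x k \<omega>)))\<^sup>2) \<partial>D)
    \<le> ennreal (C / real T)"
proof -
  interpret D: prob_space D
    using data by (simp add: independent_sampling_def)
  have x: "x k \<in> D \<rightarrow>\<^sub>M state_borel S" and y: "y k \<in> D \<rightarrow>\<^sub>M state_borel S"
    and dist: "distr D (state_borel S) (x k) = \<mu>"
    and law: "has_cond_law D (generated_sigma D (state_borel S) x {k}) (state_borel S) (y k)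
      (\<lambda>\<omega>. transition_law P S X t (x k \<omega>))" if "k \<in> {1..T}" for k
    using data that by (auto simp: independent_sampling_def)
  have [measurable]: "f \<in> borel_measurable (state_borel S)" "g \<in> borel_measurable (state_borel S)"
    "koopman P X t f \<in> borel_measurable (state_borel S)"
    using f g by (auto intro: koopman_domain_measurable measurable_koopman)
  define Z where "Z k \<omega> = (koopman P X t f (x k \<omega>) - f (y k \<omega>)) * g (x k \<omega>)" for k \<omega>
  have Zm: "Z k \<in> borel_measurable D" if "k \<in> {1..T}" for k
    using x[OF that] y[OF that] unfolding Z_def by measurable
  have sub: "subalgebra D (generated_sigma D (state_borel S) x {k})" if "k \<in> {1..T}" for k
    using x[OF that] by (intro generated_sigma_subalgebra) simp
  have xF: "x k \<in> generated_sigma D (state_borel S) x {k} \<rightarrow>\<^sub>M state_borel S" if "k \<in> {1..T}" for k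
    using measurable_space[OF x[OF that]] by (intro measurable_generated_sigma) auto
  \<comment> \<open>Required for the change of variables that replaces the expectation over
    \<open>x k\<close> by an integral over \<mu>.\<close>
  have Fm: "transition_variance P X t f \<in> borel_measurable (state_borel S)"
  proof -
    have [measurable]: "transition_law P S X t \<in> state_borel S \<rightarrow>\<^sub>M subprob_algebra (state_borel S)"
      using kernel_measurable by (rule measurable_prob_algebraD)
    have "(\<lambda>z. \<integral>\<^sup>+w. ennreal ((koopman P X t f z - f w)\<^sup>2) \<partial>transition_law P S X t z)
        \<in> borel_measurable (state_borel S)"
      by (rule nn_integral_measurable_subprob_algebra2[where N="state_borel S"]) measurable
    then show ?thesis
      by (rule measurable_cong[THEN iffD2, rotated])
        (simp add: transition_variance_eq[OF f] space_restrict_space)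
  qed
  have sq: "(\<integral>\<^sup>+\<omega>. ennreal ((Z k \<omega>)\<^sup>2) \<partial>D) \<le> ennreal C" if k: "k \<in> {1..T}" for k
  proof -
    have "(\<integral>\<^sup>+\<omega>. ennreal ((Z k \<omega>)\<^sup>2) \<partial>D)
        = (\<integral>\<^sup>+\<omega>. ennreal ((g (x k \<omega>))\<^sup>2) * transition_variance P X t f (x k \<omega>) \<partial>D)"
      unfolding Z_def
      by (rule noise_second_moment[OF D.prob_space_axioms sub[OF k] y[OF k] xF[OF k] law[OF k] f]) measurable
    also have "\<dots> = (\<integral>\<^sup>+z. ennreal ((g z)\<^sup>2) * transition_variance P X t f z \<partial>\<mu>)"
      unfolding dist[OF k, symmetric] using x[OF k] Fm by (subst nn_integral_distr) auto
    finally show ?thesis using bound by simp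
  qed
  have mean: "(\<integral>\<omega>. Z k \<omega> \<partial>D) = 0" if k: "k \<in> {1..T}" for k
    using noise_mean_zero[OF D.prob_space_axioms sub[OF k] y[OF k] xF[OF k] law[OF k] f, of "\<lambda>\<omega>. g (x k \<omega>)"]
      measurable_compose[OF xF[OF k] \<open>g \<in> borel_measurable (state_borel S)\<close>]
    by (simp add: Z_def mult.commute)
  have int: "integrable D (Z k)" if k: "k \<in> {1..T}" for k
  proof (rule D.square_integrable_imp_integrable)
    show "integrable D (\<lambda>\<omega>. (Z k \<omega>)\<^sup>2)"
      using Zm[OF k] sq[OF k] by (intro integrableI_bounded) (auto simp: le_less_trans)
  qed (rule Zm[OF k])
  \<comment> \<open>Every noise term is the same measurable function of its pair of data points, so
    independence of the pairs is inherited.\<close>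
  have "D.indep_vars (\<lambda>_. borel)
      (\<lambda>k \<omega>. (\<lambda>(u, v). (koopman P X t f u - f v) * g u) (x k \<omega>, y k \<omega>)) {1..T}"
  proof (rule D.indep_vars_compose2[where X="\<lambda>k \<omega>. (x k \<omega>, y k \<omega>)" and M'="\<lambda>_. state_borel S \<Otimes>\<^sub>M state_borel S"])
    show "D.indep_vars (\<lambda>_. state_borel S \<Otimes>\<^sub>M state_borel S) (\<lambda>k \<omega>. (x k \<omega>, y k \<omega>)) {1..T}"
      using data by (simp add: independent_sampling_def)
    show "(\<lambda>(u, v). (koopman P X t f u - f v) * g u) \<in> borel_measurable (state_borel S \<Otimes>\<^sub>M state_borel S)"
      by measurable
  qed
  then have indep: "D.indep_vars (\<lambda>_. borel) Z {1..T}"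
    by (simp add: Z_def[abs_def])
  have orth: "(\<integral>\<omega>. Z k \<omega> * Z l \<omega> \<partial>D) = 0" if "k \<in> {1..T}" "l \<in> {1..T}" "k < l" for k l
  proof -
    have "D.indep_vars (\<lambda>_. borel) Z {k, l}"
      using indep by (rule D.indep_vars_subset) (use that in auto)
    then have "(\<integral>\<omega>. (\<Prod>i\<in>{k, l}. Z i \<omega>) \<partial>D) = (\<Prod>i\<in>{k, l}. \<integral>\<omega>. Z i \<omega> \<partial>D)"
      using that int by (intro D.indep_vars_lebesgue_integral) auto
    then show ?thesis
      using that mean by simp
  qed
  show ?thesis
    using orthogonal_mean_square[OF T C Zm sq orth] by (simp add: Z_def)
qed

text \<open>The terms are martingale differences: an earlier one is already determined by the
  history up to step \<open>l\<close>, while the noise at step \<open>l\<close> has conditional mean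
  zero given that history.\<close>

lemma markov_noise_mean_square:
  assumes T: "T \<ge> 1" and C: "C \<ge> 0"
    and data: "markov_sampling D S (transition_law P S X t) T x y"
    and f: "f \<in> koopman_domain P S X t" and g: "g \<in> koopman_domain P S X t"
    and bound: "\<And>k. k \<in> {1..T} \<Longrightarrow>
      (\<integral>\<^sup>+\<omega>. ennreal ((g (x k \<omega>))\<^sup>2) * transition_variance P X t f (x k \<omega>) \<partial>D) \<le> ennreal C"
  shows "(\<integral>\<^sup>+\<omega>. ennreal ((1 / real T * (\<Sum>k=1..T. (koopman P X t f (x k \<omega>) - f (y k \<omega>)) * g (x k \<omega>)))\<^sup>2) \<partial>D)
    \<le> ennreal (C / real T)"
proof -
  interpret D: prob_space D
    using data by (simp add: markov_sampling_def)
  have x: "x k \<in> D \<rightarrow>\<^sub>M state_borel S" if "k \<in> {1..Suc T}" for k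
    using data that by (auto simp: markov_sampling_def)
  have y: "y k \<omega> = x (Suc k) \<omega>" if "k \<in> {1..T}" "\<omega> \<in> space D" for k \<omega>
    using data that by (auto simp: markov_sampling_def)
  have law: "has_cond_law D (generated_sigma D (state_borel S) x {1..k}) (state_borel S) (x (Suc k))
      (\<lambda>\<omega>. transition_law P S X t (x k \<omega>))" if "k \<in> {1..T}" for k
    using data that by (auto simp: markov_sampling_def)
  have [measurable]: "f \<in> borel_measurable (state_borel S)" "g \<in> borel_measurable (state_borel S)"
    "koopman P X t f \<in> borel_measurable (state_borel S)"
    using f g by (auto intro: koopman_domain_measurable measurable_koopman)
  \<comment> \<open>Written with the next state instead of \<open>y k\<close>, so that the noise is
    visibly a function of the chain; the two agree on \<open>space D\<close>, and the last step of
    the proof converts back.\<close>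
  define Z where "Z k \<omega> = (koopman P X t f (x k \<omega>) - f (x (Suc k) \<omega>)) * g (x k \<omega>)" for k \<omega>
  have sub: "subalgebra D (generated_sigma D (state_borel S) x {1..k})" if "k \<in> {1..T}" for k
    using that x by (intro generated_sigma_subalgebra) auto
  have xF: "x j \<in> generated_sigma D (state_borel S) x {1..k} \<rightarrow>\<^sub>M state_borel S"
    if "k \<in> {1..T}" "j \<in> {1..k}" for j k
    using that measurable_space[OF x[of j]] by (intro measurable_generated_sigma) auto
  \<comment> \<open>Stated for an arbitrary \<open>M\<close> because it is applied both to
    \<open>D\<close> and to the sigma-algebra of the history.\<close>
  have Zm: "Z k \<in> borel_measurable M"
    if [measurable]: "x k \<in> M \<rightarrow>\<^sub>M state_borel S" "x (Suc k) \<in> M \<rightarrow>\<^sub>M state_borel S" for k M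
    unfolding Z_def by measurable
  have sq: "(\<integral>\<^sup>+\<omega>. ennreal ((Z k \<omega>)\<^sup>2) \<partial>D) \<le> ennreal C" if k: "k \<in> {1..T}" for k
    unfolding Z_def using k bound[OF k]
    by (subst noise_second_moment[OF D.prob_space_axioms sub[OF k] x xF[OF k] law[OF k] f]) auto
  have orth: "(\<integral>\<omega>. Z k \<omega> * Z l \<omega> \<partial>D) = 0" if kl: "k \<in> {1..T}" "l \<in> {1..T}" "k < l" for k l
  proof -
    let ?F = "generated_sigma D (state_borel S) x {1..l}"
    \<comment> \<open>\<open>Z k\<close> involves the states with index \<open>k\<close> and
      \<open>Suc k\<close>; from \<open>k < l\<close> follows \<open>Suc k \<le> l\<close>, so both
      belong to the history up to \<open>l\<close>.\<close>
    have [measurable]: "x l \<in> ?F \<rightarrow>\<^sub>M state_borel S" "Z k \<in> borel_measurable ?F"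
      using kl xF[OF kl(2)] by (auto intro!: Zm)
    have "(\<lambda>\<omega>. Z k \<omega> * g (x l \<omega>)) \<in> borel_measurable ?F"
      by measurable
    then have "(\<integral>\<omega>. (Z k \<omega> * g (x l \<omega>)) * (koopman P X t f (x l \<omega>) - f (x (Suc l) \<omega>)) \<partial>D) = 0"
      using kl by (intro noise_mean_zero[OF D.prob_space_axioms sub x xF law f]) auto
    then show ?thesis
      by (simp add: Z_def ac_simps)
  qed
  have "(\<integral>\<^sup>+\<omega>. ennreal ((1 / real T * (\<Sum>k=1..T. Z k \<omega>))\<^sup>2) \<partial>D) \<le> ennreal (C / real T)"
    using T C sq orth by (intro orthogonal_mean_square) (auto intro!: Zm x)
  also have "(\<integral>\<^sup>+\<omega>. ennreal ((1 / real T * (\<Sum>k=1..T. Z k \<omega>))\<^sup>2) \<partial>D)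
    = (\<integral>\<^sup>+\<omega>. ennreal ((1 / real T * (\<Sum>k=1..T. (koopman P X t f (x k \<omega>) - f (y k \<omega>)) * g (x k \<omega>)))\<^sup>2) \<partial>D)"
    by (intro nn_integral_cong) (simp add: Z_def y)
  finally show ?thesis .
qed

end

section \<open>Error matrices and the operator bound\<close>

lemma K_diff_entry:
  "(K_emp P X t \<psi> T xs - K_hat \<psi> T xs ys) $ i $ j
    = 1 / real T * (\<Sum>k=1..T. (koopman P X t (\<psi> i) (xs k) - \<psi> i (ys k)) * \<psi> j (xs k))"
  by (simp add: K_emp_def K_hat_def mean_outer_def obs_vec_def left_diff_distrib sum_subtractf
      diff_divide_distrib)

lemma A_diff:
  "A_emp P X t \<psi> T xs - A_hat \<psi> T xs ys
    = (K_emp P X t \<psi> T xs - K_hat \<psi> T xs ys) ** matrix_inv (M_emp \<psi> T xs)"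
  by (simp add: A_emp_def A_hat_def matrix_matrix_mult_def vec_eq_iff left_diff_distrib sum_subtractf)

text \<open>Source of the dimension factor: the squared norm is a finite sum over all entries, and
  nonnegative integration passes through it.\<close>

lemma nn_integral_frob_norm_square_le:
  fixes A :: "'a \<Rightarrow> real^'n^'m"
  assumes [measurable]: "\<And>i j. (\<lambda>\<omega>. A \<omega> $ i $ j) \<in> borel_measurable M"
    and "c \<ge> 0" and bound: "\<And>i j. (\<integral>\<^sup>+\<omega>. ennreal ((A \<omega> $ i $ j)\<^sup>2) \<partial>M) \<le> ennreal c"
  shows "(\<integral>\<^sup>+\<omega>. ennreal ((frob_norm (A \<omega>))\<^sup>2) \<partial>M) \<le> ennreal (real CARD('m) * real CARD('n) * c)"
proof -
  have "(\<integral>\<^sup>+\<omega>. ennreal ((frob_norm (A \<omega>))\<^sup>2) \<partial>M)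
      = (\<Sum>i\<in>UNIV. \<Sum>j\<in>UNIV. \<integral>\<^sup>+\<omega>. ennreal ((A \<omega> $ i $ j)\<^sup>2) \<partial>M)"
    by (simp add: frob_norm_square sum_nonneg nn_integral_sum flip: sum_ennreal)
  also have "\<dots> \<le> (\<Sum>i\<in>(UNIV::'m set). \<Sum>j\<in>(UNIV::'n set). ennreal c)"
    by (intro sum_mono bound)
  also have "\<dots> = ennreal (real CARD('m) * real CARD('n) * c)"
    using \<open>c \<ge> 0\<close> by (simp add: ennreal_mult ennreal_of_nat_eq_real_of_nat mult.assoc)
  finally show ?thesis .
qed

text \<open>The first conjunct shows that N^2 \<gamma>' is an admissible \<gamma> for the second.
  Bounds on nonnegative integrals include finiteness, whereas the Bochner integral of a
  non-integrable norm would be zero.\<close>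

theorem corollary2p7:
  fixes P :: "'w measure" and W :: "real \<Rightarrow> 'w \<Rightarrow> real"
    and a b :: "real \<Rightarrow> 'p \<Rightarrow> real" and \<theta> :: 'p
    and S :: "real set" and X :: "real \<Rightarrow> real \<Rightarrow> 'w \<Rightarrow> real"
    and \<mu> :: "real measure" and V :: "(real \<Rightarrow> real) set"
    and \<psi> :: "'n::finite \<Rightarrow> real \<Rightarrow> real" and t \<gamma>' :: real
    and Ts :: "nat set" and D :: "nat \<Rightarrow> 'd measure"
    and x y :: "nat \<Rightarrow> nat \<Rightarrow> 'd \<Rightarrow> real"
  assumes bm: "brownian_motion P W"
    and sol: "\<And>z. z \<in> S \<Longrightarrow> strong_solution P W a b \<theta> S z (\<lambda>s. X s z)"
    and t_pos: "t > 0"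
    and kernel: "transition_law P S X t \<in> state_borel S \<rightarrow>\<^sub>M prob_algebra (state_borel S)"
    and mu: "prob_space \<mu>" "sets \<mu> = sets (state_borel S)"
    and V: "invariant_L2_subspace P S X \<mu> V"
    and psi: "\<And>i. \<psi> i \<in> V" "lin_indep_on S \<psi>"
    and \<gamma>'_pos: "\<gamma>' > 0"
    and Ts: "\<And>T. T \<in> Ts \<Longrightarrow> T \<ge> 1"
    and data:
      "(\<forall>T\<in>Ts. independent_sampling (D T) S \<mu> (transition_law P S X t) T (x T) (y T)) \<and>
       (\<forall>i j. (\<integral>\<^sup>+z. ennreal ((\<psi> j z)\<^sup>2) * transition_variance P X t (\<psi> i) z \<partial>\<mu>) \<le> ennreal \<gamma>')
       \<or>
       (\<forall>T\<in>Ts. markov_sampling (D T) S (transition_law P S X t) T (x T) (y T)) \<and>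
       (\<forall>T\<in>Ts. \<forall>k\<in>{1..T}. \<forall>i j.
          (\<integral>\<^sup>+\<omega>. ennreal ((\<psi> j (x T k \<omega>))\<^sup>2) * transition_variance P X t (\<psi> i) (x T k \<omega>) \<partial>D T)
            \<le> ennreal \<gamma>')"
  shows
    "(\<forall>T\<in>Ts.
        (\<integral>\<^sup>+\<omega>. ennreal ((frob_norm (K_emp P X t \<psi> T (\<lambda>k. x T k \<omega>)
             - K_hat \<psi> T (\<lambda>k. x T k \<omega>) (\<lambda>k. y T k \<omega>)))\<^sup>2) \<partial>D T)
          \<le> ennreal ((real CARD('n))\<^sup>2 * \<gamma>' / real T)) \<and>
     (\<forall>\<gamma> Mt. \<gamma> > 0 \<longrightarrow> Mt > 0 \<longrightarrow>
        (\<forall>T\<in>Ts.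
           (\<integral>\<^sup>+\<omega>. ennreal ((frob_norm (K_emp P X t \<psi> T (\<lambda>k. x T k \<omega>)
                - K_hat \<psi> T (\<lambda>k. x T k \<omega>) (\<lambda>k. y T k \<omega>)))\<^sup>2) \<partial>D T)
             \<le> ennreal (\<gamma> / real T)) \<longrightarrow>
        (\<forall>T\<in>Ts. AE \<omega> in D T. invertible (M_emp \<psi> T (\<lambda>k. x T k \<omega>))) \<longrightarrow>
        (\<forall>T\<in>Ts.
           (\<integral>\<^sup>+\<omega>. ennreal ((frob_norm (matrix_inv (M_emp \<psi> T (\<lambda>k. x T k \<omega>))))\<^sup>2) \<partial>D T)
             \<le> ennreal Mt) \<longrightarrow>
        (\<forall>T\<in>Ts.
           (\<integral>\<^sup>+\<omega>. ennreal (frob_norm (A_emp P X t \<psi> T (\<lambda>k. x T k \<omega>)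
                - A_hat \<psi> T (\<lambda>k. x T k \<omega>) (\<lambda>k. y T k \<omega>))) \<partial>D T)
             \<le> ennreal (sqrt (\<gamma> * Mt / real T))))"
proof -
  interpret transition_kernel P S X t
  proof
    show "X t z \<in> P \<rightarrow>\<^sub>M state_borel S" if "z \<in> S" for z
      using strong_solution_measurable[OF bm sol[OF that], of t] t_pos by simp
  qed (rule kernel)
  have dom: "\<psi> i \<in> koopman_domain P S X t" for i
    using V psi(1) t_pos by (auto simp: invariant_L2_subspace_def)
  have [measurable]: "\<psi> i \<in> borel_measurable (state_borel S)"
    "koopman P X t (\<psi> i) \<in> borel_measurable (state_borel S)" for i
    using dom by (auto intro: koopman_domain_measurable measurable_koopman)
  have x: "x T k \<in> D T \<rightarrow>\<^sub>M state_borel S" if "T \<in> Ts" "k \<in> {1..T}" for T k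
    using data that by (auto simp: independent_sampling_def markov_sampling_def)
  \<comment> \<open>For a Markov chain and \<open>k = T\<close>, the successor is the state with
    index \<open>Suc T\<close>, which is why \<open>markov_sampling\<close> asks for one state
    beyond the sample size.\<close>
  have y: "y T k \<in> D T \<rightarrow>\<^sub>M state_borel S" if "T \<in> Ts" "k \<in> {1..T}" for T k
    using data
  proof (elim disjE conjE)
    assume "\<forall>T\<in>Ts. independent_sampling (D T) S \<mu> (transition_law P S X t) T (x T) (y T)"
    then show ?thesis using that by (auto simp: independent_sampling_def)
  next
    assume "\<forall>T\<in>Ts. markov_sampling (D T) S (transition_law P S X t) T (x T) (y T)"
    then have "x T (Suc k) \<in> D T \<rightarrow>\<^sub>M state_borel S" "\<And>\<omega>. \<omega> \<in> space (D T) \<Longrightarrow> y T k \<omega> = x T (Suc k) \<omega>"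
      using that by (auto simp: markov_sampling_def)
    then show ?thesis using measurable_cong[of "D T" "y T k" "x T (Suc k)"] by blast
  qed
  let ?E = "\<lambda>T \<omega>. K_emp P X t \<psi> T (\<lambda>k. x T k \<omega>) - K_hat \<psi> T (\<lambda>k. x T k \<omega>) (\<lambda>k. y T k \<omega>)"
  let ?M = "\<lambda>T \<omega>. M_emp \<psi> T (\<lambda>k. x T k \<omega>)"
  have E: "(\<lambda>\<omega>. ?E T \<omega> $ i $ j) \<in> borel_measurable (D T)" if "T \<in> Ts" for T i j
    unfolding K_diff_entry
    by (intro borel_measurable_times borel_measurable_const borel_measurable_sum borel_measurable_diff
        measurable_compose[OF x[OF that]] measurable_compose[OF y[OF that]]) measurable
  have M: "(\<lambda>\<omega>. ?M T \<omega> $ i $ j) \<in> borel_measurable (D T)" if "T \<in> Ts" for T i j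
    unfolding M_emp_def mean_outer_def obs_vec_def vec_lambda_beta
    by (intro borel_measurable_times borel_measurable_const borel_measurable_sum
        measurable_compose[OF x[OF that]]) measurable
  have entry: "(\<integral>\<^sup>+\<omega>. ennreal ((?E T \<omega> $ i $ j)\<^sup>2) \<partial>D T) \<le> ennreal (\<gamma>' / real T)" if "T \<in> Ts" for T i j
    using data
  proof (elim disjE conjE)
    assume "\<forall>T\<in>Ts. independent_sampling (D T) S \<mu> (transition_law P S X t) T (x T) (y T)"
      and "\<forall>i j. (\<integral>\<^sup>+z. ennreal ((\<psi> j z)\<^sup>2) * transition_variance P X t (\<psi> i) z \<partial>\<mu>) \<le> ennreal \<gamma>'"
    with that show ?thesis
      unfolding K_diff_entry using Ts[OF that] \<gamma>'_pos
      by (intro independent_noise_mean_square[OF _ _ _ dom dom]) auto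
  next
    assume "\<forall>T\<in>Ts. markov_sampling (D T) S (transition_law P S X t) T (x T) (y T)"
      and "\<forall>T\<in>Ts. \<forall>k\<in>{1..T}. \<forall>i j.
        (\<integral>\<^sup>+\<omega>. ennreal ((\<psi> j (x T k \<omega>))\<^sup>2) * transition_variance P X t (\<psi> i) (x T k \<omega>) \<partial>D T) \<le> ennreal \<gamma>'"
    with that show ?thesis
      unfolding K_diff_entry using Ts[OF that] \<gamma>'_pos
      by (intro markov_noise_mean_square[OF _ _ _ dom dom]) auto
  qed
  have "(\<integral>\<^sup>+\<omega>. ennreal ((frob_norm (?E T \<omega>))\<^sup>2) \<partial>D T) \<le> ennreal ((real CARD('n))\<^sup>2 * \<gamma>' / real T)"
    if "T \<in> Ts" for T
    using nn_integral_frob_norm_square_le[OF E[OF that] _ entry[OF that]] \<gamma>'_pos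
    by (simp add: power2_eq_square)
  \<comment> \<open>The two estimated operators share the factor
    \<open>matrix_inv (?M T \<omega>)\<close>. Its second moment is at most \<open>Mt\<close> and
    that of \<open>?E T \<omega>\<close> at most \<open>\<gamma> / T\<close>, so the product under
    the root is \<open>\<gamma> * Mt / T\<close>.\<close>
  moreover have "(\<integral>\<^sup>+\<omega>. ennreal (frob_norm (A_emp P X t \<psi> T (\<lambda>k. x T k \<omega>)
        - A_hat \<psi> T (\<lambda>k. x T k \<omega>) (\<lambda>k. y T k \<omega>))) \<partial>D T) \<le> ennreal (sqrt (\<gamma> * Mt / real T))"
    if "T \<in> Ts" "\<gamma> > 0" "Mt > 0"
      "(\<integral>\<^sup>+\<omega>. ennreal ((frob_norm (?E T \<omega>))\<^sup>2) \<partial>D T) \<le> ennreal (\<gamma> / real T)"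
      "(\<integral>\<^sup>+\<omega>. ennreal ((frob_norm (matrix_inv (?M T \<omega>)))\<^sup>2) \<partial>D T) \<le> ennreal Mt" for T \<gamma> Mt
    using nn_integral_frob_norm_mult_le[OF E[OF that(1)] borel_measurable_matrix_inv[OF M[OF that(1)]]
        that(4) _ that(5)] that(2,3)
    by (simp add: A_diff)
  ultimately show ?thesis
    by blast
qed

end
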